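(* The class of relatively compact $T_1$ $\cup$-subbases of locally closed compact spaces is dual to the class of subfit round $\vee$-semilattices, in the following sense. (1) If $X$ is a locally closed compact space and $S$ is a $T_1$ $\cup$-subbasis of $X$ all of whose members are relatively compact in $X$, then $S$, ordered by inclusion, is a subfit round $\vee$-semilattice, and $x\mapsto S_x=\{s\in S:x\in s\}$ is a homeomorphism from $X$ onto $\widehat{S}$. (2) If $S$ is a subfit round $\vee$-semilattice then its spectrum $\widehat{S}$ is a locally closed compact $T_1$ space, the family $\{\widehat{S}_p:p\in S\}$ is a $T_1$ $\cup$-subbasis of $\widehat{S}$ consisting of relatively compact sets, and $S$ is faithfully represented on it, i.e. $p\leq q\Leftrightarrow\widehat{S}_p\subseteq\widehat{S}_q$ for all $p,q\in S$.
   Context: A $\vee$-semilattice is a non-empty poset in which any two elements $p,q$ have a supremum $p\vee q$. A grill in a $\vee$-semilattice $S$ is a subset $G\subseteq S$ such that $p\vee q\geq g\in G$ implies $p\in G$ or $q\in G$. The spectrum $\widehat{S}$ is the set of all proper minimal non-empty grills of $S$, i.e. grills $G$ with $\emptyset\neq G\neq S$ such that no non-empty grill is strictly contained in $G$. It carries the topology generated by the subbasis $(\widehat{S}_p)_{p\in S}$, where $\widehat{S}_p=\{G\in\widehat{S}:p\in G\}$. A non-empty finite $F\subseteq S$ is far if for all $p,q\in S$: if $p\leq q\vee f$ for all $f\in F$, then $p\leq q$. The rather below relation is defined by: $p\prec q$ iff for all $s\in S$ with $s\nleq q$ there is a finite $F\subseteq S$ such that $F\cup\{p\}$ is far and $s\leq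 f\vee q$ for all $f\in F$. $S$ is round if for every $p\in S$ there is $q\in S$ with $p\prec q$. $S$ is subfit if for all $p,q\in S$: $p\nleq q$ iff for every $p'\geq p$ there is $q'\geq q$ with $p\vee q'\geq p'$ and $p'\nleq q'$. A family $\mathcal{P}$ of subsets of a set $X$ is $T_1$ if for all $a,b\subseteq X$, each of which is a singleton or empty, $a\cap b=\emptyset$ implies that there is $p\in\mathcal{P}$ with $a\subseteq p$ and $b\cap p=\emptyset$. A subset $R$ of a space $X$ is relatively compact if every open cover of $X$ has a finite subfamily covering $R$. A $\cup$-subbasis of $X$ is a (non-empty) subbasis for the topology consisting of open sets and closed under pairwise unions. A space is locally closed compact if each point has a closed compact neighbourhood (compactness does not include Hausdorff). *)

theory Defs
  imports "HOL-Analysis.Analysis" "HOL-Algebra.Lattice"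
begin

section \<open>Semilattices and their spectra\<close>

text \<open>Posets are the carrier-based orders of HOL-Algebra, so that a family of sets ordered by
  inclusion and an abstract semilattice are treated uniformly. The locale \<open>upper_semilattice\<close> forces
  the equality of the record to be \<open>(=)\<close> but admits an empty carrier.\<close>

definition vee_semilattice :: "('a, 'm) gorder_scheme \<Rightarrow> bool"
  where "vee_semilattice L \<longleftrightarrow> upper_semilattice L \<and> carrier L \<noteq> {}"

definition inclusion_order :: "'a set set \<Rightarrow> 'a set gorder"
  where "inclusion_order S = \<lparr>carrier = S, eq = (=), le = (\<subseteq>)\<rparr>"

definition grill :: "('a, 'm) gorder_scheme \<Rightarrow> 'a set \<Rightarrow> bool"
  where "grill L G \<longleftrightarrow> G \<subseteq> carrier L \<and>
    (\<forall>p\<in>carrier L. \<forall>q\<in>carrier L. \<forall>g\<in>G. g \<sqsubseteq>\<^bsub>L\<^esub> p \<squnion>\<^bsub>L\<^esub> q \<longrightarrow> p \<in> G \<or> q \<in> G)"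

definition spectrum :: "('a, 'm) gorder_scheme \<Rightarrow> 'a set set"
  where "spectrum L = {G. grill L G \<and> G \<noteq> {} \<and> G \<noteq> carrier L \<and>
    \<not> (\<exists>H. grill L H \<and> H \<noteq> {} \<and> H \<subset> G)}"

definition spectrum_basic :: "('a, 'm) gorder_scheme \<Rightarrow> 'a \<Rightarrow> 'a set set"
  where "spectrum_basic L p = {G \<in> spectrum L. p \<in> G}"

definition spectrum_topology :: "('a, 'm) gorder_scheme \<Rightarrow> 'a set topology"
  where "spectrum_topology L =
    topology (arbitrary union_of
      (finite intersection_of (\<lambda>U. U \<in> spectrum_basic L ` carrier L) relative_to spectrum L))"

definition far :: "('a, 'm) gorder_scheme \<Rightarrow> 'a set \<Rightarrow> bool"
  where "far L F \<longleftrightarrow> finite F \<and> F \<noteq> {} \<and> F \<subseteq> carrier L \<and>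
    (\<forall>p\<in>carrier L. \<forall>q\<in>carrier L. (\<forall>f\<in>F. p \<sqsubseteq>\<^bsub>L\<^esub> q \<squnion>\<^bsub>L\<^esub> f) \<longrightarrow> p \<sqsubseteq>\<^bsub>L\<^esub> q)"

text \<open>The finite set \<open>F\<close> may be empty here.\<close>

definition rather_below :: "('a, 'm) gorder_scheme \<Rightarrow> 'a \<Rightarrow> 'a \<Rightarrow> bool"
  where "rather_below L p q \<longleftrightarrow> p \<in> carrier L \<and> q \<in> carrier L \<and>
    (\<forall>s\<in>carrier L. \<not> s \<sqsubseteq>\<^bsub>L\<^esub> q \<longrightarrow>
      (\<exists>F. finite F \<and> F \<subseteq> carrier L \<and> far L (F \<union> {p}) \<and> (\<forall>f\<in>F. s \<sqsubseteq>\<^bsub>L\<^esub> f \<squnion>\<^bsub>L\<^esub> q)))"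

definition round_order :: "('a, 'm) gorder_scheme \<Rightarrow> bool"
  where "round_order L \<longleftrightarrow> (\<forall>p\<in>carrier L. \<exists>q\<in>carrier L. rather_below L p q)"

definition subfit :: "('a, 'm) gorder_scheme \<Rightarrow> bool"
  where "subfit L \<longleftrightarrow> (\<forall>p\<in>carrier L. \<forall>q\<in>carrier L. \<not> p \<sqsubseteq>\<^bsub>L\<^esub> q \<longleftrightarrow>
    (\<forall>p'\<in>carrier L. p \<sqsubseteq>\<^bsub>L\<^esub> p' \<longrightarrow>
      (\<exists>q'\<in>carrier L. q \<sqsubseteq>\<^bsub>L\<^esub> q' \<and> p' \<sqsubseteq>\<^bsub>L\<^esub> p \<squnion>\<^bsub>L\<^esub> q' \<and> \<not> p' \<sqsubseteq>\<^bsub>L\<^esub> q')))"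


section \<open>Subbases and compactness\<close>

definition T1_family :: "'a set \<Rightarrow> 'a set set \<Rightarrow> bool"
  where "T1_family X P \<longleftrightarrow> P \<subseteq> Pow X \<and>
    (\<forall>a b. a \<subseteq> X \<and> b \<subseteq> X \<and> (a = {} \<or> is_singleton a) \<and> (b = {} \<or> is_singleton b) \<and> a \<inter> b = {}
      \<longrightarrow> (\<exists>p\<in>P. a \<subseteq> p \<and> b \<inter> p = {}))"

definition relatively_compactin :: "'a topology \<Rightarrow> 'a set \<Rightarrow> bool"
  where "relatively_compactin X R \<longleftrightarrow> R \<subseteq> topspace X \<and>
    (\<forall>\<U>. (\<forall>U\<in>\<U>. openin X U) \<and> \<Union>\<U> = topspace X \<longrightarrow>
      (\<exists>\<F>. finite \<F> \<and> \<F> \<subseteq> \<U> \<and> R \<subseteq> \<Union>\<F>))"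

text \<open>The empty intersection counts as the whole space, so a subbasis need not cover the space.\<close>

definition union_subbasis :: "'a topology \<Rightarrow> 'a set set \<Rightarrow> bool"
  where "union_subbasis X S \<longleftrightarrow> S \<noteq> {} \<and> (\<forall>s\<in>S. openin X s) \<and> (\<forall>s\<in>S. \<forall>t\<in>S. s \<union> t \<in> S) \<and>
    openin X = arbitrary union_of (finite intersection_of (\<lambda>s. s \<in> S) relative_to topspace X)"

definition locally_closed_compact_space :: "'a topology \<Rightarrow> bool"
  where "locally_closed_compact_space X \<longleftrightarrow> (\<forall>x\<in>topspace X. \<exists>U K.
    openin X U \<and> x \<in> U \<and> U \<subseteq> K \<and> closedin X K \<and> compactin X K)"


section \<open>Basic facts\<close>

lemma topspace_spectrum_topology [simp]: "topspace (spectrum_topology L) = spectrum L"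
  unfolding spectrum_topology_def by (rule topspace_subbase)

lemma join_inclusion_order:
  assumes "s \<in> S" "t \<in> S" "s \<union> t \<in> S"
  shows "s \<squnion>\<^bsub>inclusion_order S\<^esub> t = s \<union> t"
proof -
  let ?L = "inclusion_order S"
  have "least ?L (s \<union> t) (Upper ?L {s, t})"
    using assms by (simp add: least_def Upper_def inclusion_order_def)
  moreover have "u = s \<union> t" if "least ?L u (Upper ?L {s, t})" for u
  proof
    have "s \<union> t \<in> Upper ?L {s, t}"
      using assms by (simp add: Upper_def inclusion_order_def)
    then show "u \<subseteq> s \<union> t"
      using that by (simp add: least_def inclusion_order_def)
    have "u \<in> Upper ?L {s, t}"
      using that by (simp add: least_def)
    then show "s \<union> t \<subseteq> u"
      using assms by (simp add: Upper_def inclusion_order_def)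
  qed
  ultimately have "(SOME u. least ?L u (Upper ?L {s, t})) = s \<union> t"
    by (rule some_equality)
  then show ?thesis
    by (simp add: join_def Lattice.sup_def)
qed

end

theory Submission
  imports Defs
begin

text \<open>
  Complements of grills are ideals, so points of the spectrum correspond to maximal proper ideals.
  If \<open>S\<close> is a relatively compact \<open>T\<^sub>1\<close> \<open>\<union>\<close>-subbasis, any compact set missing a point \<open>x\<close> lies in a
  member of \<open>S\<close> missing \<open>x\<close>; applied to \<open>cl t - s\<close> with \<open>x \<in> s\<close>, this gives subfitness and the
  maximality of \<open>{s \<in> S. x \<notin> s}\<close>, while compactness of closures makes every maximal ideal of this form.

  Conversely, let \<open>p \<prec> p'\<close> in a subfit round semilattice. Writing \<open>a \<le>\<^sub>p b\<close> if \<open>a \<le> b\<close> or there is a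
  finite \<open>F\<close> with \<open>F \<union> {p}\<close> far and \<open>a \<le> f \<squnion> b\<close> for all \<open>f \<in> F\<close>, every ideal without an element
  \<open>i\<close> satisfying \<open>p' \<le>\<^sub>p i\<close> extends to a maximal proper ideal with the same property. Together
  with subfitness this separates elements by points; together with Alexander's subbase theorem it
  shows that the closure of the basic set of \<open>p\<close>, which lies in that of \<open>p'\<close>, is compact.
\<close>

section \<open>Neighbourhoods from a subbasis, and T1 families\<close>

lemma subbase_neighbourhood:
  assumes "(arbitrary union_of (finite intersection_of (\<lambda>U. U \<in> B) relative_to Y)) T" "x \<in> T"
  obtains F where "finite F" "F \<subseteq> B" "x \<in> \<Inter>F" "Y \<inter> \<Inter>F \<subseteq> T"
proof -
  obtain V where "(finite intersection_of (\<lambda>U. U \<in> B) relative_to Y) V" "x \<in> V" "V \<subseteq> T"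
    using assms unfolding union_of_def by blast
  then show thesis
    unfolding relative_to_def intersection_of_def by (auto intro!: that)
qed

text \<open>The four cases of empty sets and singletons: two empty sets only ask for
  \<open>P \<noteq> {}\<close>, and disjointness of two singletons is distinctness of their
  points.\<close>

lemma T1_family_iff:
  "T1_family X P \<longleftrightarrow> P \<subseteq> Pow X \<and> P \<noteq> {} \<and> (\<forall>x\<in>X. \<exists>p\<in>P. x \<in> p) \<and> (\<forall>x\<in>X. \<exists>p\<in>P. x \<notin> p) \<and>
    (\<forall>x\<in>X. \<forall>y\<in>X. x \<noteq> y \<longrightarrow> (\<exists>p\<in>P. x \<in> p \<and> y \<notin> p))" (is "?lhs \<longleftrightarrow> ?rhs")
proof
  assume ?lhs
  then have P: "P \<subseteq> Pow X"
    and T1: "\<And>a b. \<lbrakk>a \<subseteq> X; b \<subseteq> X; a = {} \<or> is_singleton a; b = {} \<or> is_singleton b; a \<inter> b = {}\<rbrakk>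
      \<Longrightarrow> \<exists>p\<in>P. a \<subseteq> p \<and> b \<inter> p = {}"
    unfolding T1_family_def by auto
  have "P \<noteq> {}"
    using T1[of "{}" "{}"] by auto
  moreover have "\<exists>p\<in>P. x \<in> p" "\<exists>p\<in>P. x \<notin> p" if "x \<in> X" for x
    using T1[of "{x}" "{}"] T1[of "{}" "{x}"] that by auto
  moreover have "\<exists>p\<in>P. x \<in> p \<and> y \<notin> p" if "x \<in> X" "y \<in> X" "x \<noteq> y" for x y
    using T1[of "{x}" "{y}"] that by auto
  ultimately show ?rhs using P by simp
next
  assume R: ?rhs
  have sep: "\<exists>p\<in>P. a \<subseteq> p \<and> b \<inter> p = {}"
    if ab: "a \<subseteq> X" "b \<subseteq> X" "a = {} \<or> is_singleton a" "b = {} \<or> is_singleton b" "a \<inter> b = {}" for a b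
  proof -
    consider "a = {}" "b = {}" | x where "a = {x}" "b = {}" | y where "a = {}" "b = {y}"
      | x y where "a = {x}" "b = {y}"
      using ab unfolding is_singleton_def by blast
    then show ?thesis
      by cases (use R ab in auto)
  qed
  show ?lhs
    unfolding T1_family_def
  proof (intro conjI allI impI; (elim conjE)?)
    show "P \<subseteq> Pow X" using R by (rule conjunct1)
  qed (rule sep)
qed


section \<open>Ideals and the spectrum\<close>

text \<open>The contrapositive of the grill condition. The case \<open>r = p \<squnion> q\<close>
  gives closure under joins, the case \<open>p = q\<close> downward closure; the empty set and the
  whole carrier count as ideals.\<close>

definition vee_ideal :: "('a, 'm) gorder_scheme \<Rightarrow> 'a set \<Rightarrow> bool"
  where "vee_ideal L I \<longleftrightarrow> I \<subseteq> carrier L \<and>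
    (\<forall>p\<in>I. \<forall>q\<in>I. \<forall>r\<in>carrier L. r \<sqsubseteq>\<^bsub>L\<^esub> p \<squnion>\<^bsub>L\<^esub> q \<longrightarrow> r \<in> I)"

lemma grill_iff_vee_ideal:
  "grill L G \<longleftrightarrow> G \<subseteq> carrier L \<and> vee_ideal L (carrier L - G)"
  unfolding grill_def vee_ideal_def by blast

text \<open>In the spectrum, \<open>a\<close> lies below \<open>b\<close> on the closure of \<open>p\<close>.\<close>

definition below_on :: "('a, 'm) gorder_scheme \<Rightarrow> 'a \<Rightarrow> 'a \<Rightarrow> 'a \<Rightarrow> bool"
  where "below_on L p a b \<longleftrightarrow> a \<sqsubseteq>\<^bsub>L\<^esub> b \<or>
    (\<exists>F. finite F \<and> F \<subseteq> carrier L \<and> far L (F \<union> {p}) \<and> (\<forall>f\<in>F. a \<sqsubseteq>\<^bsub>L\<^esub> f \<squnion>\<^bsub>L\<^esub> b))"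

context upper_semilattice
begin

section \<open>Order calculations with joins\<close>

lemma join_le_iff:
  "\<lbrakk>x \<in> carrier L; y \<in> carrier L; z \<in> carrier L\<rbrakk> \<Longrightarrow> x \<squnion> y \<sqsubseteq> z \<longleftrightarrow> x \<sqsubseteq> z \<and> y \<sqsubseteq> z"
  by (meson join_closed join_le join_left join_right le_trans)

lemma le_joinI1:
  "\<lbrakk>x \<sqsubseteq> y; x \<in> carrier L; y \<in> carrier L; z \<in> carrier L\<rbrakk> \<Longrightarrow> x \<sqsubseteq> y \<squnion> z"
  by (meson join_closed join_left le_trans)

lemma le_joinI2:
  "\<lbrakk>x \<sqsubseteq> z; x \<in> carrier L; y \<in> carrier L; z \<in> carrier L\<rbrakk> \<Longrightarrow> x \<sqsubseteq> y \<squnion> z"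
  by (meson join_closed join_right le_trans)

lemma join_mono:
  "\<lbrakk>x \<sqsubseteq> x'; y \<sqsubseteq> y'; x \<in> carrier L; y \<in> carrier L; x' \<in> carrier L; y' \<in> carrier L\<rbrakk>
    \<Longrightarrow> x \<squnion> y \<sqsubseteq> x' \<squnion> y'"
  by (simp add: join_le_iff le_joinI1 le_joinI2)

lemma join_assoc:
  "\<lbrakk>x \<in> carrier L; y \<in> carrier L; z \<in> carrier L\<rbrakk> \<Longrightarrow> (x \<squnion> y) \<squnion> z = x \<squnion> (y \<squnion> z)"
  using weak_join_assoc by (simp add: eq_is_equal)

section \<open>Far sets and the order on the closure of an element\<close>

lemma far_insertD:
  assumes "far L (F \<union> {p})" "a \<in> carrier L" "b \<in> carrier L"
    "\<And>f. f \<in> F \<Longrightarrow> a \<sqsubseteq> b \<squnion> f" "a \<sqsubseteq> b \<squnion> p"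
  shows "a \<sqsubseteq> b"
  using assms unfolding far_def by blast

lemma rather_below_imp_below_on:
  "\<lbrakk>rather_below L p q; s \<in> carrier L\<rbrakk> \<Longrightarrow> below_on L p s q"
  unfolding rather_below_def below_on_def by blast

text \<open>Otherwise \<open>s = p\<close> in the definition yields \<open>F\<close> with
  \<open>F \<union> {p}\<close> far and \<open>p\<close> below \<open>f \<squnion> q\<close> for all
  \<open>f \<in> F\<close>; as \<open>p\<close> is also below \<open>q \<squnion> p\<close>, farness
  gives \<open>p \<sqsubseteq> q\<close> after all.\<close>

lemma rather_below_imp_le:
  assumes "rather_below L p q"
  shows "p \<sqsubseteq> q"
proof (rule ccontr)
  assume *: "\<not> p \<sqsubseteq> q"
  have c: "p \<in> carrier L" "q \<in> carrier L"
    using assms unfolding rather_below_def by auto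
  then obtain F where F: "F \<subseteq> carrier L" "far L (F \<union> {p})" "\<forall>f\<in>F. p \<sqsubseteq> f \<squnion> q"
    using assms * unfolding rather_below_def by blast
  have "p \<sqsubseteq> q"
  proof (rule far_insertD[OF F(2) c])
    show "p \<sqsubseteq> q \<squnion> f" if "f \<in> F" for f
      using F(3) that by (subst join_comm) blast
  qed (use c join_right in blast)
  with * show False by simp
qed

text \<open>When \<open>F\<close> witnesses \<open>below_on\<close>, the second hypothesis supplies
  the one test that farness of \<open>F \<union> {p}\<close> still lacks, the test at
  \<open>p\<close>.\<close>

lemma below_on_self_absorb:
  assumes "below_on L p a b" "a \<sqsubseteq> b \<squnion> p" "a \<in> carrier L" "b \<in> carrier L"
  shows "a \<sqsubseteq> b"
  using assms unfolding below_on_def by (metis far_insertD join_comm)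

lemma below_on_mono:
  assumes "below_on L p a b" "a' \<sqsubseteq> a" "b \<sqsubseteq> b'"
    "a \<in> carrier L" "b \<in> carrier L" "a' \<in> carrier L" "b' \<in> carrier L"
  shows "below_on L p a' b'"
proof -
  have "a' \<sqsubseteq> f \<squnion> b'" if "a \<sqsubseteq> f \<squnion> b" "f \<in> carrier L" for f
    using assms that by (meson join_closed join_mono le_refl le_trans)
  moreover have "a' \<sqsubseteq> b'" if "a \<sqsubseteq> b"
    using assms that by (meson le_trans)
  ultimately show ?thesis
    using assms(1) unfolding below_on_def by (meson subsetD)
qed

lemma below_on_join_left:
  assumes "below_on L p a b" "a \<in> carrier L" "b \<in> carrier L" "c \<in> carrier L"
  shows "below_on L p (c \<squnion> a) (c \<squnion> b)"
proof -
  have "c \<squnion> a \<sqsubseteq> f \<squnion> (c \<squnion> b)" if "a \<sqsubseteq> f \<squnion> b" "f \<in> carrier L" for f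
  proof -
    have "f \<squnion> b \<sqsubseteq> f \<squnion> (c \<squnion> b)"
      using assms that by (intro join_mono) (auto simp: join_right)
    then have "a \<sqsubseteq> f \<squnion> (c \<squnion> b)"
      using assms that by (meson join_closed le_trans)
    then show ?thesis
      using assms that by (simp add: join_le_iff le_joinI2 join_left)
  qed
  moreover have "c \<squnion> a \<sqsubseteq> c \<squnion> b" if "a \<sqsubseteq> b"
    using assms that by (intro join_mono) auto
  ultimately show ?thesis
    using assms(1) unfolding below_on_def by (meson subsetD)
qed

text \<open>The members of \<open>F\<close> have no common point on the closure of \<open>p\<close>,
  so lying below every \<open>f \<squnion> b\<close> there means lying below \<open>b\<close>.
  Algebraically, each \<open>f\<close> is replaced by a finite set of elements above it, and the
  union of these sets is the new witness.\<close>

lemma below_on_far: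
  assumes far: "far L (F \<union> {p})" and F: "finite F" "F \<subseteq> carrier L"
    and ab: "a \<in> carrier L" "b \<in> carrier L"
    and below: "\<And>f. f \<in> F \<Longrightarrow> below_on L p a (f \<squnion> b)"
  shows "below_on L p a b"
proof -
  have p: "p \<in> carrier L"
    using far unfolding far_def by auto
  \<comment> \<open>\<open>good f H\<close> lets \<open>H\<close> stand in for \<open>f\<close>:
    \<open>a\<close> is below \<open>h \<squnion> b\<close> for each \<open>h \<in> H\<close>, and a
    pair \<open>c\<close>, \<open>d\<close> that passes the tests at \<open>p\<close> and at all of
    \<open>H\<close> passes the one at \<open>f\<close>.\<close>
  define good where "good f H \<longleftrightarrow> finite H \<and> H \<subseteq> carrier L \<and> (\<forall>h\<in>H. a \<sqsubseteq> h \<squnion> b) \<and>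
      (\<forall>c\<in>carrier L. \<forall>d\<in>carrier L. (\<forall>h\<in>H. c \<sqsubseteq> d \<squnion> h) \<and> c \<sqsubseteq> d \<squnion> p \<longrightarrow> c \<sqsubseteq> d \<squnion> f)" for f H
  have "\<exists>H. good f H" if f: "f \<in> F" for f
  proof (cases "a \<sqsubseteq> f \<squnion> b")
    case True
    then show ?thesis
      using f F unfolding good_def by (intro exI[of _ "{f}"]) auto
  next
    case False
    then obtain G where G: "finite G" "G \<subseteq> carrier L" "far L (G \<union> {p})"
      "\<forall>g\<in>G. a \<sqsubseteq> g \<squnion> (f \<squnion> b)"
      using below[OF f] unfolding below_on_def by blast
    have fc: "f \<in> carrier L" using f F by auto
    \<comment> \<open>The joins \<open>g \<squnion> f\<close> are the substitute for
      \<open>f\<close>; farness of \<open>G \<union> {p}\<close> is applied with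
      \<open>d \<squnion> f\<close> on the right-hand side.\<close>
    have "c \<sqsubseteq> d \<squnion> f" if cd: "c \<in> carrier L" "d \<in> carrier L"
      and h: "\<forall>h\<in>(\<lambda>g. g \<squnion> f) ` G. c \<sqsubseteq> d \<squnion> h" and cp: "c \<sqsubseteq> d \<squnion> p" for c d
    proof (rule far_insertD[OF G(3)])
      show "c \<sqsubseteq> d \<squnion> f \<squnion> g" if "g \<in> G" for g
      proof -
        have "c \<sqsubseteq> d \<squnion> (f \<squnion> g)"
          using h that by (subst join_comm[of L f]) blast
        then show ?thesis
          using cd fc that G(2) by (simp add: join_assoc subset_iff)
      qed
      have "d \<squnion> p \<sqsubseteq> d \<squnion> f \<squnion> p"
        using cd fc p by (intro join_mono) (auto simp: join_left)
      then show "c \<sqsubseteq> d \<squnion> f \<squnion> p"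
        using cp cd fc p by (meson join_closed le_trans)
    qed (use cd fc in auto)
    moreover have "a \<sqsubseteq> g \<squnion> f \<squnion> b" if "g \<in> G" for g
      using that G fc ab by (simp add: join_assoc subset_iff)
    ultimately show ?thesis
      using G fc unfolding good_def by (intro exI[of _ "(\<lambda>g. g \<squnion> f) ` G"]) auto
  qed
  then have "\<forall>f\<in>F. \<exists>H. good f H" by blast
  then obtain H where good: "\<forall>f\<in>F. good f (H f)" by (rule bchoice[THEN exE])
  then have H: "\<And>f. f \<in> F \<Longrightarrow> finite (H f)" "\<And>f. f \<in> F \<Longrightarrow> H f \<subseteq> carrier L"
    "\<And>f h. f \<in> F \<Longrightarrow> h \<in> H f \<Longrightarrow> a \<sqsubseteq> h \<squnion> b"
    "\<And>f c d. \<lbrakk>f \<in> F; c \<in> carrier L; d \<in> carrier L; \<And>h. h \<in> H f \<Longrightarrow> c \<sqsubseteq> d \<squnion> h; c \<sqsubseteq> d \<squnion> p\<rbrakk>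
      \<Longrightarrow> c \<sqsubseteq> d \<squnion> f"
    using good unfolding good_def by auto
  \<comment> \<open>By the last clause of \<open>good\<close>, tests at the substitutes and at
    \<open>p\<close> imply those at \<open>F \<union> {p}\<close>, which is far.\<close>
  have "far L ((\<Union>f\<in>F. H f) \<union> {p})"
    unfolding far_def
  proof (intro conjI ballI impI)
    fix c d
    assume cd: "c \<in> carrier L" "d \<in> carrier L"
      and *: "\<forall>f\<in>(\<Union>f\<in>F. H f) \<union> {p}. c \<sqsubseteq> d \<squnion> f"
    show "c \<sqsubseteq> d"
    proof (rule far_insertD[OF far cd])
      show "c \<sqsubseteq> d \<squnion> f" if "f \<in> F" for f
        by (rule H(4)[OF that cd]) (use * that in auto)
    qed (use * in auto)
  qed (use H F p in auto)
  then show ?thesis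
    unfolding below_on_def using H F
    by (intro disjI2 exI[of _ "\<Union>f\<in>F. H f"]) auto
qed

text \<open>For a witness \<open>F\<close> of the first relation, each \<open>f \<squnion> b\<close>
  is below \<open>f \<squnion> c\<close> on the closure of \<open>p\<close>, hence so is
  \<open>a\<close>; \<open>below_on_far\<close> then removes \<open>f\<close>.\<close>

lemma below_on_trans:
  assumes "below_on L p a b" "below_on L p b c"
    "a \<in> carrier L" "b \<in> carrier L" "c \<in> carrier L"
  shows "below_on L p a c"
proof (cases "a \<sqsubseteq> b")
  case True
  then show ?thesis
    using assms by (meson below_on_mono le_refl)
next
  case False
  then obtain F where F: "finite F" "F \<subseteq> carrier L" "far L (F \<union> {p})" "\<forall>f\<in>F. a \<sqsubseteq> f \<squnion> b"
    using assms(1) unfolding below_on_def by blast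
  show ?thesis
  proof (rule below_on_far[OF F(3,1,2)])
    fix f
    assume f: "f \<in> F"
    then have fc: "f \<in> carrier L" using F by auto
    have "below_on L p (f \<squnion> b) (f \<squnion> c)"
      using assms fc by (intro below_on_join_left) auto
    then show "below_on L p a (f \<squnion> c)"
      using F(4) f fc assms by (meson below_on_mono join_closed le_refl)
  qed (use assms in auto)
qed

section \<open>Ideals: directedness and adjoining an element\<close>

lemma vee_ideal_joinI: "\<lbrakk>vee_ideal L I; i \<in> I; j \<in> I\<rbrakk> \<Longrightarrow> i \<squnion> j \<in> I"
  unfolding vee_ideal_def by (meson join_closed le_refl subsetD)

lemma vee_ideal_downI: "\<lbrakk>vee_ideal L I; i \<in> I; r \<in> carrier L; r \<sqsubseteq> i\<rbrakk> \<Longrightarrow> r \<in> I"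
  unfolding vee_ideal_def by (meson le_joinI1 subsetD)

lemma vee_ideal_principal: "q \<in> carrier L \<Longrightarrow> vee_ideal L {r \<in> carrier L. r \<sqsubseteq> q}"
  unfolding vee_ideal_def by (auto intro: le_trans[OF _ join_le])

text \<open>An ideal is directed, so finitely many demands that persist upwards and are met
  separately are met by one element; \<open>I \<noteq> {}\<close> covers
  \<open>F = {}\<close>.\<close>

lemma vee_ideal_common:
  assumes I: "vee_ideal L I" "I \<noteq> {}" and F: "finite F" "\<And>f. f \<in> F \<Longrightarrow> \<exists>i\<in>I. P f i"
    and mono: "\<And>f i j. \<lbrakk>f \<in> F; P f i; i \<sqsubseteq> j; i \<in> I; j \<in> I\<rbrakk> \<Longrightarrow> P f j"
  obtains i where "i \<in> I" "\<And>f. f \<in> F \<Longrightarrow> P f i"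
proof -
  have Ic: "I \<subseteq> carrier L" using I unfolding vee_ideal_def by auto
  have "\<exists>i\<in>I. \<forall>f\<in>F. P f i"
    using F mono
  proof (induction F)
    case empty
    then show ?case using I by auto
  next
    case (insert f F)
    have "\<exists>i\<in>I. \<forall>f\<in>F. P f i"
      by (rule insert.IH) (use insert.prems in auto)
    then obtain i j where ij: "i \<in> I" "\<forall>f\<in>F. P f i" "j \<in> I" "P f j"
      using insert.prems(1)[of f] by auto
    have "i \<sqsubseteq> i \<squnion> j" "j \<sqsubseteq> i \<squnion> j" "i \<squnion> j \<in> I"
      using ij Ic vee_ideal_joinI[OF I(1)] by (auto intro: join_left join_right)
    then have "\<forall>f'\<in>insert f F. P f' (i \<squnion> j)"
      using ij insert.prems(2)[of _ i "i \<squnion> j"] insert.prems(2)[of f j "i \<squnion> j"] by auto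
    then show ?case
      using \<open>i \<squnion> j \<in> I\<close> by blast
  qed
  then show thesis using that by blast
qed

text \<open>For nonempty \<open>I\<close> this is the ideal generated by \<open>I\<close> and
  \<open>s\<close>; the bounds \<open>s \<squnion> i\<close> and \<open>s \<squnion> j\<close> are
  absorbed by \<open>s \<squnion> (i \<squnion> j)\<close>.\<close>

lemma vee_ideal_join_element:
  assumes I: "vee_ideal L I" and s: "s \<in> carrier L"
  shows "vee_ideal L {r \<in> carrier L. \<exists>i\<in>I. r \<sqsubseteq> s \<squnion> i}"
proof -
  have Ic: "I \<subseteq> carrier L" using I unfolding vee_ideal_def by auto
  have "\<exists>i\<in>I. r \<sqsubseteq> s \<squnion> i"
    if "p \<in> carrier L" "q \<in> carrier L" "r \<in> carrier L" "r \<sqsubseteq> p \<squnion> q"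
      "i \<in> I" "j \<in> I" "p \<sqsubseteq> s \<squnion> i" "q \<sqsubseteq> s \<squnion> j" for p q r i j
  proof
    have c: "i \<in> carrier L" "j \<in> carrier L" using that Ic by auto
    have "s \<squnion> i \<sqsubseteq> s \<squnion> (i \<squnion> j)" "s \<squnion> j \<sqsubseteq> s \<squnion> (i \<squnion> j)"
      using c s by (auto intro!: join_mono simp: join_left join_right)
    then have "p \<squnion> q \<sqsubseteq> s \<squnion> (i \<squnion> j)"
      using that c s by (meson join_closed join_le le_trans)
    then show "r \<sqsubseteq> s \<squnion> (i \<squnion> j)"
      using that c s by (meson join_closed le_trans)
    show "i \<squnion> j \<in> I" using that vee_ideal_joinI[OF I] by blast
  qed
  then show ?thesis
    unfolding vee_ideal_def by blast
qed

section \<open>Points of the spectrum as complements of maximal proper ideals\<close>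

text \<open>Minimality of \<open>G\<close> is maximality of the complementary ideal, put
  elementwise: that ideal together with any \<open>s \<in> G\<close> generates the whole
  carrier.\<close>

lemma spectrum_iff:
  "G \<in> spectrum L \<longleftrightarrow> G \<noteq> {} \<and> G \<subset> carrier L \<and> vee_ideal L (carrier L - G) \<and>
    (\<forall>s\<in>G. \<forall>t\<in>carrier L. \<exists>i\<in>carrier L - G. t \<sqsubseteq> s \<squnion> i)"
proof (intro iffI)
  assume G: "G \<in> spectrum L"
  then have grill: "grill L G" and ne: "G \<noteq> {}" "G \<noteq> carrier L"
    and min: "\<And>H. grill L H \<Longrightarrow> H \<subset> G \<Longrightarrow> H = {}"
    unfolding spectrum_def by auto
  have I: "G \<subseteq> carrier L" "vee_ideal L (carrier L - G)"
    using grill by (auto simp: grill_iff_vee_ideal)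
  have "\<exists>i\<in>carrier L - G. t \<sqsubseteq> s \<squnion> i" if s: "s \<in> G" and t: "t \<in> carrier L" for s t
  proof -
    have sc: "s \<in> carrier L" using s I by auto
    \<comment> \<open>\<open>J\<close> is the ideal generated by \<open>carrier L - G\<close> and
      \<open>s\<close>, so its complement is a grill inside \<open>G\<close> without
      \<open>s\<close>.\<close>
    define J where "J = {r \<in> carrier L. \<exists>i\<in>carrier L - G. r \<sqsubseteq> s \<squnion> i}"
    have "carrier L - (carrier L - J) = J"
      unfolding J_def by auto
    then have "grill L (carrier L - J)"
      using vee_ideal_join_element[OF I(2) sc] unfolding grill_iff_vee_ideal J_def by simp
    moreover have "s \<in> J"
      using ne I sc unfolding J_def by (auto intro: join_left)
    moreover have "carrier L - G \<subseteq> J"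
      using sc unfolding J_def by (auto intro: join_right)
    ultimately have "carrier L - J = {}"
      using s by (intro min) auto
    then show ?thesis
      using t unfolding J_def by blast
  qed
  with I ne show "G \<noteq> {} \<and> G \<subset> carrier L \<and> vee_ideal L (carrier L - G) \<and>
    (\<forall>s\<in>G. \<forall>t\<in>carrier L. \<exists>i\<in>carrier L - G. t \<sqsubseteq> s \<squnion> i)" by auto
next
  assume *: "G \<noteq> {} \<and> G \<subset> carrier L \<and> vee_ideal L (carrier L - G) \<and>
    (\<forall>s\<in>G. \<forall>t\<in>carrier L. \<exists>i\<in>carrier L - G. t \<sqsubseteq> s \<squnion> i)"
  have False if H: "grill L H" "H \<noteq> {}" "H \<subset> G" for H
  proof -
    \<comment> \<open>\<open>h\<close> lies below a join of two elements outside \<open>H\<close>,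
      namely \<open>s\<close> and some \<open>i \<notin> G\<close>, against the grill property of
      \<open>H\<close>.\<close>
    obtain h s where hs: "h \<in> H" "s \<in> G" "s \<notin> H" using H by blast
    then have "h \<in> carrier L" using * H by auto
    then have "\<exists>i\<in>carrier L - G. h \<sqsubseteq> s \<squnion> i" using * hs(2) by simp
    then obtain i where i: "i \<in> carrier L" "i \<notin> G" "h \<sqsubseteq> s \<squnion> i" by blast
    then have "s \<in> H \<or> i \<in> H"
      using H(1) hs * unfolding grill_def by blast
    then show False using hs i H by auto
  qed
  then show "G \<in> spectrum L"
    unfolding spectrum_def using * by (auto simp: grill_iff_vee_ideal)
qed

lemma spectrum_subset: "G \<in> spectrum L \<Longrightarrow> G \<subseteq> carrier L"
  by (auto simp: spectrum_iff)

lemma spectrum_join_iff: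
  assumes "G \<in> spectrum L" "p \<in> carrier L" "q \<in> carrier L"
  shows "p \<squnion> q \<in> G \<longleftrightarrow> p \<in> G \<or> q \<in> G"
proof -
  have I: "vee_ideal L (carrier L - G)"
    using assms by (auto simp: spectrum_iff)
  show ?thesis
    using vee_ideal_joinI[OF I, of p q] vee_ideal_downI[OF I, of "p \<squnion> q" p]
      vee_ideal_downI[OF I, of "p \<squnion> q" q] assms spectrum_subset[OF assms(1)]
    by (auto simp: join_left join_right)
qed

lemma spectrum_up: "\<lbrakk>G \<in> spectrum L; p \<in> G; p \<sqsubseteq> q; q \<in> carrier L\<rbrakk> \<Longrightarrow> q \<in> G"
  using vee_ideal_downI[of "carrier L - G" q p] by (auto simp: spectrum_iff)

text \<open>For \<open>s \<in> G\<close>, maximality and directedness of the complement would give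
  one \<open>i \<notin> G\<close> with \<open>s \<sqsubseteq> f \<squnion> i\<close> for all
  \<open>f \<in> F\<close>. Farness then puts \<open>s\<close> below \<open>i\<close>, forcing
  \<open>i \<in> G\<close>.\<close>

lemma not_far_subset_spectrum:
  assumes G: "G \<in> spectrum L" and F: "far L F"
  shows "\<not> F \<subseteq> G"
proof
  assume FG: "F \<subseteq> G"
  have I: "vee_ideal L (carrier L - G)" "carrier L - G \<noteq> {}" "G \<noteq> {}" "G \<subseteq> carrier L"
    and max: "\<And>s t. s \<in> G \<Longrightarrow> t \<in> carrier L \<Longrightarrow> \<exists>i\<in>carrier L - G. t \<sqsubseteq> s \<squnion> i"
    using G unfolding spectrum_iff by auto
  obtain s where s: "s \<in> G" "s \<in> carrier L" using I by blast
  obtain i where i: "i \<in> carrier L - G" "\<And>f. f \<in> F \<Longrightarrow> s \<sqsubseteq> f \<squnion> i"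
  proof (rule vee_ideal_common[OF I(1,2)])
    show "finite F" using F unfolding far_def by blast
    show "\<exists>i\<in>carrier L - G. s \<sqsubseteq> f \<squnion> i" if "f \<in> F" for f
      using that FG max s by blast
    show "s \<sqsubseteq> f \<squnion> j" if "f \<in> F" "s \<sqsubseteq> f \<squnion> i" "i \<sqsubseteq> j" "i \<in> carrier L - G" "j \<in> carrier L - G" for f i j
    proof -
      have "f \<in> carrier L" using that FG I by auto
      then have "f \<squnion> i \<sqsubseteq> f \<squnion> j" using that by (intro join_mono) auto
      then show ?thesis
        using that s \<open>f \<in> carrier L\<close> by (meson DiffD1 join_closed le_trans)
    qed
  qed blast
  then have "\<forall>f\<in>F. s \<sqsubseteq> i \<squnion> f" by (simp add: join_comm)
  then have "s \<sqsubseteq> i" using F s i unfolding far_def by blast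
  then show False
    using spectrum_up[OF G, of s i] s i by auto
qed

text \<open>The condition on \<open>J\<close> says that no member of \<open>J\<close> covers the closure of \<open>p\<close>. An ideal that is
  maximal with this property is already a maximal proper ideal.\<close>

lemma spectrum_extension:
  assumes rb: "rather_below L p p'" and J: "vee_ideal L J" "J \<noteq> {}"
    and avoid: "\<And>i. i \<in> J \<Longrightarrow> \<not> below_on L p p' i"
  obtains G where "G \<in> spectrum L" "G \<inter> J = {}" "\<And>i. i \<in> carrier L - G \<Longrightarrow> \<not> below_on L p p' i"
proof -
  have p: "p \<in> carrier L" "p' \<in> carrier L" using rb unfolding rather_below_def by auto
  define A where "A = {I. vee_ideal L I \<and> J \<subseteq> I \<and> (\<forall>i\<in>I. \<not> below_on L p p' i)}"
  have "\<exists>M\<in>A. \<forall>X\<in>A. M \<subseteq> X \<longrightarrow> X = M"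
  proof (rule subset_Zorn_nonempty)
    show "A \<noteq> {}" using J avoid unfolding A_def by auto
    fix C
    assume C: "C \<noteq> {}" "subset.chain A C"
    then have CA: "C \<subseteq> A" by (simp add: subset.chain_def)
    have "r \<in> \<Union>C" if "x \<in> \<Union>C" "y \<in> \<Union>C" "r \<in> carrier L" "r \<sqsubseteq> x \<squnion> y" for x y r
    proof -
      obtain I1 I2 where "I1 \<in> C" "x \<in> I1" "I2 \<in> C" "y \<in> I2"
        using \<open>x \<in> \<Union>C\<close> \<open>y \<in> \<Union>C\<close> by blast
      moreover have "I1 \<subseteq> I2 \<or> I2 \<subseteq> I1"
        using C(2) calculation unfolding subset_chain_def by simp
      ultimately obtain I where "I \<in> C" "x \<in> I" "y \<in> I" by blast
      then show ?thesis
        using CA that unfolding A_def vee_ideal_def by blast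
    qed
    moreover have "\<Union>C \<subseteq> carrier L" "J \<subseteq> \<Union>C" "\<forall>i\<in>\<Union>C. \<not> below_on L p p' i"
      using CA C(1) unfolding A_def vee_ideal_def by blast+
    ultimately show "\<Union>C \<in> A"
      unfolding A_def vee_ideal_def by blast
  qed
  then obtain I where IA: "I \<in> A" and Imax: "\<And>K. K \<in> A \<Longrightarrow> I \<subseteq> K \<Longrightarrow> K = I" by blast
  then have I: "vee_ideal L I" "J \<subseteq> I" "\<And>i. i \<in> I \<Longrightarrow> \<not> below_on L p p' i"
    unfolding A_def by auto
  have Ic: "I \<subseteq> carrier L" using I unfolding vee_ideal_def by auto
  have "I \<noteq> {}" using I(2) J(2) by auto
  have "p' \<notin> I" using I(3) p unfolding below_on_def by auto
  \<comment> \<open>Adjoining \<open>s\<close> to \<open>I\<close> must break avoidance, by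
    maximality of \<open>I\<close> in \<open>A\<close>.\<close>
  have enlarge: "\<exists>i\<in>I. below_on L p p' (s \<squnion> i)" if s: "s \<in> carrier L" "s \<notin> I" for s
  proof -
    define K where "K = {r \<in> carrier L. \<exists>i\<in>I. r \<sqsubseteq> s \<squnion> i}"
    have "vee_ideal L K" unfolding K_def by (rule vee_ideal_join_element[OF I(1) s(1)])
    moreover have IK: "I \<subseteq> K" using Ic s join_right unfolding K_def by blast
    moreover have "s \<in> K" using Ic s I(2) J(2) join_left unfolding K_def by blast
    ultimately have "\<exists>k\<in>K. below_on L p p' k"
      using Imax[of K] s I(2) unfolding A_def by blast
    then obtain k i where k: "k \<in> carrier L" "below_on L p p' k" "i \<in> I" "k \<sqsubseteq> s \<squnion> i"
      unfolding K_def by blast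
    then have "below_on L p p' (s \<squnion> i)"
      using below_on_mono[OF k(2) _ k(4)] p s Ic by auto
    then show ?thesis using k by blast
  qed
  have max: "\<exists>i\<in>I. t \<sqsubseteq> s \<squnion> i" if s: "s \<in> carrier L" "s \<notin> I" and t: "t \<in> carrier L" for s t
  proof -
    obtain i where i: "i \<in> I" "below_on L p p' (s \<squnion> i)"
      using enlarge s by blast
    define v where "v = s \<squnion> i"
    have v: "v \<in> carrier L" using s i Ic unfolding v_def by auto
    \<comment> \<open>As \<open>p \<prec> p'\<close>, every \<open>t\<close> is below
      \<open>p'\<close> on the closure of \<open>p\<close>, hence below \<open>v\<close> there by
      transitivity.\<close>
    have tv: "below_on L p t v"
      using below_on_trans[OF rather_below_imp_below_on[OF rb t], of v] i(2) t p v
      unfolding v_def by blast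
    show ?thesis
    proof (cases "t \<sqsubseteq> v")
      case True
      then show ?thesis using i unfolding v_def by auto
    next
      case False
      then obtain F where F: "finite F" "F \<subseteq> carrier L" "far L (F \<union> {p})" "\<forall>f\<in>F. t \<sqsubseteq> f \<squnion> v"
        using tv unfolding below_on_def by blast
      \<comment> \<open>If \<open>F\<close> missed \<open>I\<close>, each \<open>f \<in> F\<close>
        joined with an element of \<open>I\<close> would lie above \<open>p'\<close> on the closure
        of \<open>p\<close>; a common such \<open>j \<in> I\<close> and \<open>below_on_far\<close>
        would put \<open>p'\<close> below \<open>j\<close> there, which \<open>I\<close>
        avoids.\<close>
      have "\<exists>f\<in>F. f \<in> I"
      proof (rule ccontr)
        assume *: "\<not> (\<exists>f\<in>F. f \<in> I)"
        obtain j where j: "j \<in> I" "\<And>f. f \<in> F \<Longrightarrow> below_on L p p' (f \<squnion> j)"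
        proof (rule vee_ideal_common[OF I(1) _ F(1)])
          show "I \<noteq> {}" by fact
          show "\<exists>i\<in>I. below_on L p p' (f \<squnion> i)" if "f \<in> F" for f
            using that * F enlarge by blast
          show "below_on L p p' (f \<squnion> j)"
            if "f \<in> F" "below_on L p p' (f \<squnion> i)" "i \<sqsubseteq> j" "i \<in> I" "j \<in> I" for f i j
          proof -
            have "f \<in> carrier L" "i \<in> carrier L" "j \<in> carrier L" using that F Ic by auto
            then show ?thesis
              using that p by (intro below_on_mono[OF that(2)] join_mono) auto
          qed
        qed blast
        then have "below_on L p p' j"
          using p(2) Ic by (intro below_on_far[OF F(3,1,2) _ _ j(2)]) auto
        then show False using I(3) j by blast
      qed
      then obtain f where f: "f \<in> F" "f \<in> I" by blast
      have "f \<squnion> v = s \<squnion> (i \<squnion> f)"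
        using s i f Ic unfolding v_def by (metis join_assoc join_comm subsetD)
      then show ?thesis
        using F(4) f i vee_ideal_joinI[OF I(1)] by metis
    qed
  qed
  have G: "carrier L - (carrier L - I) = I" using Ic by auto
  show thesis
  proof (rule that)
    show "carrier L - I \<in> spectrum L"
      unfolding spectrum_iff G using I(1) \<open>I \<noteq> {}\<close> Ic p \<open>p' \<notin> I\<close> max by blast
  qed (use I G in auto)
qed

section \<open>Separation by points and the faithful representation\<close>

text \<open>Subfitness at some \<open>p'\<close> with \<open>p \<prec> p'\<close> gives
  \<open>q'\<close> above \<open>q\<close> with \<open>p'\<close> below
  \<open>p \<squnion> q'\<close> but not below \<open>q'\<close>, hence not below \<open>q'\<close>
  on the closure of \<open>p\<close> either. A suitable point avoiding the principal ideal of
  \<open>q'\<close> contains \<open>p'\<close>, hence \<open>p \<squnion> q'\<close>, hence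
  \<open>p\<close>.\<close>

lemma spectrum_separation:
  assumes "subfit L" "round_order L" and p: "p \<in> carrier L" and q: "q \<in> carrier L"
    and "\<not> p \<sqsubseteq> q"
  obtains G where "G \<in> spectrum L" "p \<in> G" "q \<notin> G"
proof -
  obtain p' where p': "p' \<in> carrier L" "rather_below L p p'"
    using assms unfolding round_order_def by blast
  obtain q' where q': "q' \<in> carrier L" "q \<sqsubseteq> q'" "p' \<sqsubseteq> p \<squnion> q'" "\<not> p' \<sqsubseteq> q'"
    using assms p' rather_below_imp_le[OF p'(2)] unfolding subfit_def by meson
  have "\<not> below_on L p p' q'"
    using below_on_self_absorb[of p p' q'] q' p' by (auto simp: join_comm)
  then obtain G where G: "G \<in> spectrum L" "G \<inter> {r \<in> carrier L. r \<sqsubseteq> q'} = {}"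
    "\<And>i. i \<in> carrier L - G \<Longrightarrow> \<not> below_on L p p' i"
    using spectrum_extension[OF p'(2) vee_ideal_principal[OF q'(1)]] below_on_mono[of p p' _ p' q'] p' q'
    by (smt (verit, ccfv_threshold) empty_iff le_refl mem_Collect_eq)
  have "p' \<in> G"
    using G(3) p' unfolding below_on_def by auto
  then have "p \<squnion> q' \<in> G"
    using spectrum_up[OF G(1)] q' p by auto
  then have "p \<in> G" "q \<notin> G"
    using G(2) p q q' by (auto simp: spectrum_join_iff[OF G(1)])
  with G(1) show thesis by (rule that)
qed

lemma le_iff_spectrum_basic_subset:
  assumes "subfit L" "round_order L" "p \<in> carrier L" "q \<in> carrier L"
  shows "p \<sqsubseteq> q \<longleftrightarrow> spectrum_basic L p \<subseteq> spectrum_basic L q"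
proof
  assume "p \<sqsubseteq> q"
  then show "spectrum_basic L p \<subseteq> spectrum_basic L q"
    using spectrum_up assms unfolding spectrum_basic_def by blast
next
  assume *: "spectrum_basic L p \<subseteq> spectrum_basic L q"
  show "p \<sqsubseteq> q"
  proof (rule ccontr)
    assume "\<not> p \<sqsubseteq> q"
    then obtain G where "G \<in> spectrum L" "p \<in> G" "q \<notin> G"
      using spectrum_separation[OF assms] by blast
    then show False
      using * unfolding spectrum_basic_def by blast
  qed
qed

lemma spectrum_basic_join:
  "\<lbrakk>p \<in> carrier L; q \<in> carrier L\<rbrakk>
    \<Longrightarrow> spectrum_basic L (p \<squnion> q) = spectrum_basic L p \<union> spectrum_basic L q"
  by (auto simp: spectrum_basic_def spectrum_join_iff)

subsection \<open>Topology of the spectrum\<close>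

lemma openin_spectrum_topology:
  "openin (spectrum_topology L) = arbitrary union_of
    (finite intersection_of (\<lambda>U. U \<in> spectrum_basic L ` carrier L) relative_to spectrum L)"
  unfolding spectrum_topology_def by (rule topology_inverse'[OF istopology_subbase])

lemma openin_spectrum_finite:
  assumes "finite F" "F \<subseteq> carrier L"
  shows "openin (spectrum_topology L) {G \<in> spectrum L. F \<subseteq> G}"
proof -
  have "(finite intersection_of (\<lambda>U. U \<in> spectrum_basic L ` carrier L)) (\<Inter>(spectrum_basic L ` F))"
    unfolding intersection_of_def using assms by (intro exI[of _ "spectrum_basic L ` F"]) auto
  then have "(finite intersection_of (\<lambda>U. U \<in> spectrum_basic L ` carrier L) relative_to spectrum L)
      (spectrum L \<inter> \<Inter>(spectrum_basic L ` F))"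
    by (rule relative_to_inc)
  moreover have "spectrum L \<inter> \<Inter>(spectrum_basic L ` F) = {G \<in> spectrum L. F \<subseteq> G}"
    by (auto simp: spectrum_basic_def)
  ultimately show ?thesis
    unfolding openin_spectrum_topology by (simp add: arbitrary_union_of_inc)
qed

lemma openin_spectrum_basic: "p \<in> carrier L \<Longrightarrow> openin (spectrum_topology L) (spectrum_basic L p)"
  using openin_spectrum_finite[of "{p}"] by (simp add: spectrum_basic_def)

lemma spectrum_neighbourhood:
  assumes "openin (spectrum_topology L) T" "G \<in> T"
  obtains F where "finite F" "F \<subseteq> G" "{H \<in> spectrum L. F \<subseteq> H} \<subseteq> T"
proof -
  obtain \<F> where \<F>: "finite \<F>" "\<F> \<subseteq> spectrum_basic L ` carrier L" "G \<in> \<Inter>\<F>" "spectrum L \<inter> \<Inter>\<F> \<subseteq> T"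
    using subbase_neighbourhood assms unfolding openin_spectrum_topology by metis
  obtain F where F: "finite F" "F \<subseteq> carrier L" "\<F> = spectrum_basic L ` F"
    using finite_subset_image[OF \<F>(1,2)] by blast
  show thesis
    by (rule that[of F]) (use \<F> F in \<open>auto simp: spectrum_basic_def\<close>)
qed

text \<open>Distinct minimal grills are incomparable, which separates points; being nonempty and
  proper gives the cases with one empty set.\<close>

lemma T1_spectrum_basic:
  assumes "carrier L \<noteq> {}"
  shows "T1_family (spectrum L) (spectrum_basic L ` carrier L)"
proof -
  have sep: "\<exists>p\<in>carrier L. p \<in> G \<and> p \<notin> H" if "G \<in> spectrum L" "H \<in> spectrum L" "G \<noteq> H" for G H
  proof -
    have "\<not> G \<subset> H" using that unfolding spectrum_def by auto
    then show ?thesis using that spectrum_subset[of G] by blast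
  qed
  have "(\<exists>p\<in>carrier L. p \<in> G) \<and> (\<exists>p\<in>carrier L. p \<notin> G)" if "G \<in> spectrum L" for G
    using that unfolding spectrum_iff by blast
  with sep assms show ?thesis
    unfolding T1_family_iff spectrum_basic_def by auto
qed

section \<open>Closures of basic sets and their compactness\<close>

text \<open>If \<open>b \<notin> G\<close>, the witness \<open>F\<close> lies in \<open>G\<close>
  because each \<open>f \<squnion> b\<close> does. The neighbourhood of \<open>G\<close> given by
  \<open>F\<close> then meets the basic set of \<open>p\<close> in a point containing the far set
  \<open>F \<union> {p}\<close>, which is impossible.\<close>

lemma closure_spectrum_basic_below_on:
  assumes G: "G \<in> spectrum_topology L closure_of spectrum_basic L p"
    and ab: "below_on L p a b" "a \<in> G" "b \<in> carrier L"
  shows "b \<in> G"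
proof (rule ccontr)
  assume bG: "b \<notin> G"
  have Gs: "G \<in> spectrum L" using G by (simp add: in_closure_of)
  have "\<not> a \<sqsubseteq> b" using spectrum_up[OF Gs ab(2)] ab(3) bG by blast
  then obtain F where F: "finite F" "F \<subseteq> carrier L" "far L (F \<union> {p})" "\<forall>f\<in>F. a \<sqsubseteq> f \<squnion> b"
    using ab(1) unfolding below_on_def by blast
  have "F \<subseteq> G"
  proof
    fix f assume f: "f \<in> F"
    then have fc: "f \<in> carrier L" using F by auto
    then have "f \<squnion> b \<in> G"
      using spectrum_up[OF Gs ab(2)] F(4) f ab(3) by auto
    then show "f \<in> G" using spectrum_join_iff[OF Gs fc ab(3)] bG by simp
  qed
  then have "G \<in> {G \<in> spectrum L. F \<subseteq> G}" using Gs by simp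
  with openin_spectrum_finite[OF F(1,2)] obtain H where "H \<in> spectrum_basic L p" "F \<subseteq> H"
    using G unfolding in_closure_of by (metis (no_types, lifting) mem_Collect_eq)
  then show False
    using not_far_subset_spectrum[OF _ F(3), of H] by (auto simp: spectrum_basic_def)
qed

text \<open>A point of the closure contains some \<open>s\<close>, and \<open>p \<prec> p'\<close>
  makes every \<open>s\<close> below \<open>p'\<close> on that closure.\<close>

lemma closure_spectrum_basic_subset:
  assumes "rather_below L p p'"
  shows "spectrum_topology L closure_of spectrum_basic L p \<subseteq> spectrum_basic L p'"
proof
  fix G
  assume G: "G \<in> spectrum_topology L closure_of spectrum_basic L p"
  then have Gs: "G \<in> spectrum L" by (simp add: in_closure_of)
  then obtain s where s: "s \<in> G" "s \<in> carrier L"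
    unfolding spectrum_iff by blast
  have "p' \<in> G"
    using closure_spectrum_basic_below_on[OF G rather_below_imp_below_on[OF assms s(2)] s(1)] assms
    unfolding rather_below_def by blast
  then show "G \<in> spectrum_basic L p'" using Gs by (simp add: spectrum_basic_def)
qed

text \<open>Consider the ideal \<open>J\<close> of elements covered by finitely many members of
  \<open>Q\<close>. If \<open>p'\<close> is below some \<open>i \<in> J\<close> on the closure, then
  \<open>i\<close> covers it. Otherwise some point avoids \<open>J\<close>; it lies in the closure
  but in no basic set from \<open>Q\<close>, a contradiction.\<close>

lemma spectrum_closure_compact_subbasic:
  assumes "subfit L" "round_order L" and rb: "rather_below L p p'" and Q: "Q \<subseteq> carrier L"
    and cover: "spectrum_topology L closure_of spectrum_basic L p \<subseteq> (\<Union>q\<in>Q. spectrum_basic L q)"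
  obtains Q' where "finite Q'" "Q' \<subseteq> Q"
    "spectrum_topology L closure_of spectrum_basic L p \<subseteq> (\<Union>q\<in>Q'. spectrum_basic L q)"
proof (cases "Q = {}")
  case True
  then show thesis using that[of "{}"] cover by auto
next
  case False
  let ?K = "spectrum_topology L closure_of spectrum_basic L p"
  have p: "p \<in> carrier L" "p' \<in> carrier L" using rb unfolding rather_below_def by auto
  define J where "J = {r \<in> carrier L. \<exists>Q'. finite Q' \<and> Q' \<subseteq> Q \<and>
    spectrum_basic L r \<subseteq> (\<Union>q\<in>Q'. spectrum_basic L q)}"
  have J: "vee_ideal L J"
    unfolding vee_ideal_def
  proof (intro conjI ballI impI)
    fix x y r
    assume *: "x \<in> J" "y \<in> J" "r \<in> carrier L" "r \<sqsubseteq> x \<squnion> y"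
    then obtain Q1 Q2 where "finite Q1" "Q1 \<subseteq> Q" "spectrum_basic L x \<subseteq> (\<Union>q\<in>Q1. spectrum_basic L q)"
      "finite Q2" "Q2 \<subseteq> Q" "spectrum_basic L y \<subseteq> (\<Union>q\<in>Q2. spectrum_basic L q)"
      unfolding J_def by blast
    moreover have "spectrum_basic L r \<subseteq> spectrum_basic L x \<union> spectrum_basic L y"
      using * le_iff_spectrum_basic_subset[OF assms(1,2), of r "x \<squnion> y"]
      unfolding J_def by (auto simp: spectrum_basic_join)
    ultimately have "finite (Q1 \<union> Q2)" "Q1 \<union> Q2 \<subseteq> Q"
      "spectrum_basic L r \<subseteq> (\<Union>q\<in>Q1 \<union> Q2. spectrum_basic L q)" by auto
    then show "r \<in> J" using * unfolding J_def by blast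
  qed (auto simp: J_def)
  have QJ: "Q \<subseteq> J"
  proof
    fix q assume "q \<in> Q"
    then show "q \<in> J" using Q unfolding J_def by (auto intro!: exI[of _ "{q}"])
  qed
  show thesis
  proof (cases "\<exists>i\<in>J. below_on L p p' i")
    case True
    then obtain i where i: "i \<in> J" "below_on L p p' i" by blast
    have ic: "i \<in> carrier L" using i J unfolding vee_ideal_def by auto
    have "i \<in> G" if "G \<in> ?K" for G
      using closure_spectrum_basic_below_on[OF that i(2) _ ic] closure_spectrum_basic_subset[OF rb] that
      by (auto simp: spectrum_basic_def)
    then have "?K \<subseteq> spectrum_basic L i"
      by (auto simp: spectrum_basic_def in_closure_of)
    moreover obtain Q' where "finite Q'" "Q' \<subseteq> Q" "spectrum_basic L i \<subseteq> (\<Union>q\<in>Q'. spectrum_basic L q)"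
      using i unfolding J_def by blast
    ultimately show thesis by (intro that[of Q']) auto
  next
    case none: False
    then obtain G where G: "G \<in> spectrum L" "G \<inter> J = {}"
      "\<And>i. i \<in> carrier L - G \<Longrightarrow> \<not> below_on L p p' i"
      using spectrum_extension[OF rb J] QJ False by blast
    have I: "vee_ideal L (carrier L - G)" "carrier L - G \<noteq> {}"
      using G(1) by (auto simp: spectrum_iff)
    \<comment> \<open>If the neighbourhood of \<open>G\<close> given by
      \<open>F \<subseteq> G\<close> missed the basic set of \<open>p\<close>, separation by points
      would make \<open>F \<union> {p}\<close> far. Maximality and directedness of the complement
      give one \<open>i \<notin> G\<close> with \<open>p'\<close> below all
      \<open>f \<squnion> i\<close>, so \<open>p'\<close> is below \<open>i\<close> on the closure,
      which \<open>G\<close> excludes.\<close>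
    have "G \<in> ?K"
      unfolding in_closure_of
    proof (intro conjI allI impI)
      fix T
      assume T: "G \<in> T \<and> openin (spectrum_topology L) T"
      then obtain F where F: "finite F" "F \<subseteq> G" "{H \<in> spectrum L. F \<subseteq> H} \<subseteq> T"
        using spectrum_neighbourhood by blast
      have Fc: "F \<subseteq> carrier L" using F spectrum_subset[OF G(1)] by auto
      show "\<exists>y. y \<in> spectrum_basic L p \<and> y \<in> T"
      proof (rule ccontr)
        assume *: "\<nexists>y. y \<in> spectrum_basic L p \<and> y \<in> T"
        have "far L (F \<union> {p})"
          unfolding far_def
        proof (intro conjI ballI impI)
          fix a b
          assume ab: "a \<in> carrier L" "b \<in> carrier L" and le: "\<forall>f\<in>F \<union> {p}. a \<sqsubseteq> b \<squnion> f"
          show "a \<sqsubseteq> b"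
          proof (rule ccontr)
            assume "\<not> a \<sqsubseteq> b"
            then obtain H where H: "H \<in> spectrum L" "a \<in> H" "b \<notin> H"
              using spectrum_separation[OF assms(1,2) ab] by blast
            have "f \<in> H" if f: "f \<in> F \<union> {p}" for f
            proof -
              have "f \<in> carrier L" using f Fc p by auto
              then have "b \<squnion> f \<in> H" using spectrum_up[OF H(1,2)] le f ab by auto
              then show ?thesis using spectrum_join_iff[OF H(1)] ab \<open>f \<in> carrier L\<close> H(3) by blast
            qed
            then show False using * F(3) H by (auto simp: spectrum_basic_def)
          qed
        qed (use F Fc p in auto)
        moreover obtain i where i: "i \<in> carrier L - G" "\<And>f. f \<in> F \<Longrightarrow> p' \<sqsubseteq> f \<squnion> i"
        proof (rule vee_ideal_common[OF I F(1)])
          show "\<exists>i\<in>carrier L - G. p' \<sqsubseteq> f \<squnion> i" if "f \<in> F" for f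
            using that F(2) G(1) p unfolding spectrum_iff by blast
          show "p' \<sqsubseteq> f \<squnion> j"
            if "f \<in> F" "p' \<sqsubseteq> f \<squnion> i" "i \<sqsubseteq> j" "i \<in> carrier L - G" "j \<in> carrier L - G" for f i j
          proof -
            have "f \<in> carrier L" using that Fc by auto
            then have "f \<squnion> i \<sqsubseteq> f \<squnion> j" using that by (intro join_mono) auto
            then show ?thesis
              using that p \<open>f \<in> carrier L\<close> by (meson DiffD1 join_closed le_trans)
          qed
        qed blast
        ultimately have "below_on L p p' i"
          unfolding below_on_def using F Fc by blast
        then show False using G(3) i by blast
      qed
    qed (use G in simp)
    then obtain q where "q \<in> Q" "q \<in> G" using cover by (auto simp: spectrum_basic_def)
    then show thesis using G QJ by blast
  qed
qed

text \<open>Alexander's subbase theorem reduces covers to those by basic sets, once the subspace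
  topology is seen to be generated by their traces. The basic sets cover the closure since that of
  some \<open>p'\<close> with \<open>p \<prec> p'\<close> alone does.\<close>

lemma compactin_spectrum_closure:
  assumes "subfit L" "round_order L" "p \<in> carrier L"
  shows "compactin (spectrum_topology L) (spectrum_topology L closure_of spectrum_basic L p)"
proof -
  let ?K = "spectrum_topology L closure_of spectrum_basic L p"
  let ?B = "spectrum_basic L ` carrier L"
  obtain p' where rb: "rather_below L p p'" and p': "p' \<in> carrier L"
    using assms unfolding round_order_def by blast
  have Ks: "?K \<subseteq> spectrum L"
    using closure_of_subset_topspace[of "spectrum_topology L" "spectrum_basic L p"] by simp
  have "topology (arbitrary union_of (finite intersection_of (\<lambda>x. x \<in> ?B) relative_to ?K)) =
      subtopology (spectrum_topology L) ?K" (is "?Y = _")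
  proof (rule topology_eq[THEN iffD2], intro allI)
    fix T
    have "openin (subtopology (spectrum_topology L) ?K) = (openin (spectrum_topology L) relative_to ?K)"
      by (simp add: openin_relative_to)
    also have "\<dots> = openin ?Y"
      unfolding openin_spectrum_topology arbitrary_union_of_relative_to relative_to_relative_to
        topology_inverse'[OF istopology_subbase] Int_absorb1[OF Ks] ..
    finally show "openin ?Y T = openin (subtopology (spectrum_topology L) ?K) T" by simp
  qed
  then have "compact_space (subtopology (spectrum_topology L) ?K)"
  proof (rule Alexander_subbase_alt[where \<B> = ?B, rotated 2])
    show "?K \<subseteq> \<Union>?B"
      using closure_spectrum_basic_subset[OF rb] p' by auto
    fix C
    assume C: "C \<subseteq> ?B" "?K \<subseteq> \<Union>C"
    then obtain Q where Q: "Q \<subseteq> carrier L" "C = spectrum_basic L ` Q"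
      by (meson subset_imageE)
    then obtain Q' where "finite Q'" "Q' \<subseteq> Q" "?K \<subseteq> (\<Union>q\<in>Q'. spectrum_basic L q)"
      using spectrum_closure_compact_subbasic[OF assms(1,2) rb Q(1)] C by metis
    then show "\<exists>C'. finite C' \<and> C' \<subseteq> C \<and> ?K \<subseteq> \<Union>C'"
      using Q by (intro exI[of _ "spectrum_basic L ` Q'"]) auto
  qed
  then show ?thesis
    using Ks by (simp add: compactin_subspace)
qed

lemma relatively_compactin_spectrum_basic:
  assumes "subfit L" "round_order L" "p \<in> carrier L"
  shows "relatively_compactin (spectrum_topology L) (spectrum_basic L p)"
  unfolding relatively_compactin_def
proof (intro conjI allI impI)
  let ?K = "spectrum_topology L closure_of spectrum_basic L p"
  show sub: "spectrum_basic L p \<subseteq> topspace (spectrum_topology L)"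
    by (auto simp: spectrum_basic_def)
  fix \<U>
  assume "(\<forall>U\<in>\<U>. openin (spectrum_topology L) U) \<and> \<Union>\<U> = topspace (spectrum_topology L)"
  moreover have "?K \<subseteq> topspace (spectrum_topology L)" by (rule closure_of_subset_topspace)
  ultimately obtain \<F> where "finite \<F>" "\<F> \<subseteq> \<U>" "?K \<subseteq> \<Union>\<F>"
    using compactin_spectrum_closure[OF assms] unfolding compactin_def by (metis subset_eq)
  then show "\<exists>\<F>. finite \<F> \<and> \<F> \<subseteq> \<U> \<and> spectrum_basic L p \<subseteq> \<Union>\<F>"
    using closure_of_subset[OF sub] by (meson subset_trans)
qed

lemma locally_closed_compact_spectrum:
  assumes "subfit L" "round_order L"
  shows "locally_closed_compact_space (spectrum_topology L)"
  unfolding locally_closed_compact_space_def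
proof
  fix G
  assume "G \<in> topspace (spectrum_topology L)"
  then have G: "G \<in> spectrum L" by simp
  then obtain p where "p \<in> G" "p \<in> carrier L"
    unfolding spectrum_iff by blast
  with G have p: "p \<in> carrier L" "G \<in> spectrum_basic L p" by (auto simp: spectrum_basic_def)
  have "spectrum_basic L p \<subseteq> spectrum_topology L closure_of spectrum_basic L p"
    by (intro closure_of_subset) (auto simp: spectrum_basic_def)
  then show "\<exists>U K. openin (spectrum_topology L) U \<and> G \<in> U \<and> U \<subseteq> K \<and>
      closedin (spectrum_topology L) K \<and> compactin (spectrum_topology L) K"
    using p
    by (intro exI[of _ "spectrum_basic L p"]
        exI[of _ "spectrum_topology L closure_of spectrum_basic L p"])
      (simp add: openin_spectrum_basic compactin_spectrum_closure[OF assms])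
qed

lemma t1_spectrum: "carrier L \<noteq> {} \<Longrightarrow> t1_space (spectrum_topology L)"
  unfolding t1_space_def using T1_spectrum_basic unfolding T1_family_iff
  by simp (meson openin_spectrum_basic)

lemma union_subbasis_spectrum:
  assumes "carrier L \<noteq> {}"
  shows "union_subbasis (spectrum_topology L) (spectrum_basic L ` carrier L)"
proof -
  have "s \<union> t \<in> spectrum_basic L ` carrier L"
    if "s \<in> spectrum_basic L ` carrier L" "t \<in> spectrum_basic L ` carrier L" for s t
    using that by (auto simp flip: spectrum_basic_join)
  moreover have "\<forall>s\<in>spectrum_basic L ` carrier L. openin (spectrum_topology L) s"
    by (simp add: openin_spectrum_basic)
  ultimately show ?thesis
    unfolding union_subbasis_def topspace_spectrum_topology
    using assms openin_spectrum_topology by blast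
qed

end


section \<open>Relatively compact subbases\<close>

locale relatively_compact_subbasis =
  fixes X :: "'x topology" and S :: "'x set set"
  assumes lcc: "locally_closed_compact_space X" and subbasis: "union_subbasis X S"
    and T1: "T1_family (topspace X) S" and relcomp: "s \<in> S \<Longrightarrow> relatively_compactin X s"
begin

lemma S_subset: "s \<in> S \<Longrightarrow> s \<subseteq> topspace X"
  using T1 unfolding T1_family_def by auto

lemma S_open: "s \<in> S \<Longrightarrow> openin X s"
  using subbasis unfolding union_subbasis_def by auto

lemma S_union: "\<lbrakk>s \<in> S; t \<in> S\<rbrakk> \<Longrightarrow> s \<union> t \<in> S"
  using subbasis unfolding union_subbasis_def by auto

lemma S_separation:
  "\<lbrakk>x \<in> topspace X; y \<in> topspace X; x \<noteq> y\<rbrakk> \<Longrightarrow> \<exists>s\<in>S. x \<in> s \<and> y \<notin> s"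
  "x \<in> topspace X \<Longrightarrow> \<exists>s\<in>S. x \<in> s"
  "x \<in> topspace X \<Longrightarrow> \<exists>s\<in>S. x \<notin> s"
  using T1 unfolding T1_family_iff by auto

lemma openin_X:
  "openin X = arbitrary union_of (finite intersection_of (\<lambda>s. s \<in> S) relative_to topspace X)"
  using subbasis unfolding union_subbasis_def by auto

section \<open>Compact sets and members of the subbasis\<close>

text \<open>Finitely many open sets inside closed compact sets cover \<open>s\<close>. The union of
  these closed compact sets is closed, so it contains the closure of \<open>s\<close>, and compact,
  so that closed subset is compact.\<close>

lemma compactin_closure:
  assumes "s \<in> S"
  shows "compactin X (X closure_of s)"
proof -
  let ?\<U> = "{U. openin X U \<and> (\<exists>K. U \<subseteq> K \<and> closedin X K \<and> compactin X K)}"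
  have "\<Union>?\<U> = topspace X"
  proof
    show "\<Union>?\<U> \<subseteq> topspace X" using openin_subset by blast
    show "topspace X \<subseteq> \<Union>?\<U>"
    proof
      fix x
      assume "x \<in> topspace X"
      then obtain U K where "openin X U" "x \<in> U" "U \<subseteq> K" "closedin X K" "compactin X K"
        using lcc unfolding locally_closed_compact_space_def by metis
      then show "x \<in> \<Union>?\<U>" by blast
    qed
  qed
  then obtain \<F> where \<F>: "finite \<F>" "\<F> \<subseteq> ?\<U>" "s \<subseteq> \<Union>\<F>"
    using relcomp[OF assms] unfolding relatively_compactin_def
    by (metis (no_types, lifting) mem_Collect_eq)
  then have "\<forall>U\<in>\<F>. \<exists>K. U \<subseteq> K \<and> closedin X K \<and> compactin X K" by blast
  then obtain k where k: "\<forall>U\<in>\<F>. U \<subseteq> k U \<and> closedin X (k U) \<and> compactin X (k U)"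
    by (rule bchoice[THEN exE])
  have cl: "closedin X (\<Union>(k ` \<F>))" and co: "compactin X (\<Union>(k ` \<F>))"
    using k \<F>(1) by (auto intro!: closedin_Union compactin_Union)
  have "\<Union>\<F> \<subseteq> \<Union>(k ` \<F>)" using k by (auto 0 3)
  then have "s \<subseteq> \<Union>(k ` \<F>)" using \<F>(3) by (rule subset_trans[rotated])
  then have "X closure_of s \<subseteq> \<Union>(k ` \<F>)" using cl by (rule closure_of_minimal)
  then show ?thesis using co by (metis closed_compactin closedin_closure_of)
qed

text \<open>A finite subcover merges into one member by closure under unions;
  \<open>T \<noteq> {}\<close> covers the empty subcover.\<close>

lemma compact_cover:
  assumes K: "compactin X K" "K \<subseteq> \<Union>T" and T: "T \<subseteq> S" "T \<noteq> {}"
    and union: "\<And>s t. \<lbrakk>s \<in> T; t \<in> T\<rbrakk> \<Longrightarrow> s \<union> t \<in> T"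
  obtains t where "t \<in> T" "K \<subseteq> t"
proof -
  obtain \<F> where \<F>: "finite \<F>" "\<F> \<subseteq> T" "K \<subseteq> \<Union>\<F>"
    using K T(1) S_open unfolding compactin_def by (metis subsetD)
  have "\<exists>t\<in>T. \<Union>\<F> \<subseteq> t"
    using \<F>(1,2)
  proof (induction \<F>)
    case empty
    then show ?case using T(2) by auto
  next
    case (insert s \<F>)
    then obtain t where "t \<in> T" "\<Union>\<F> \<subseteq> t" by auto
    then show ?case using union[of s t] insert.prems by (intro bexI[of _ "s \<union> t"]) auto
  qed
  then obtain t where "t \<in> T" "\<Union>\<F> \<subseteq> t" by (rule bexE)
  then show thesis using \<F>(3) by (intro that[of t]) auto
qed

text \<open>The members of \<open>S\<close> missing \<open>x\<close> are closed under unions and, by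
  the T1 property, cover \<open>K\<close>; that there is one at all matters for empty
  \<open>K\<close>.\<close>

lemma compact_avoid:
  assumes K: "compactin X K" and x: "x \<in> topspace X" "x \<notin> K"
  obtains t where "t \<in> S" "K \<subseteq> t" "x \<notin> t"
proof -
  have "K \<subseteq> \<Union>{t \<in> S. x \<notin> t}"
    using S_separation(1) x compactin_subset_topspace[OF K] by blast
  then obtain t where "t \<in> {t \<in> S. x \<notin> t}" "K \<subseteq> t"
  proof (rule compact_cover[OF K])
    show "{t \<in> S. x \<notin> t} \<noteq> {}" using S_separation(3)[OF x(1)] by auto
  qed (auto intro: S_union)
  then show thesis by (intro that[of t]) auto
qed

lemma compactin_closure_diff:
  assumes "s \<in> S" "t \<in> S"
  shows "compactin X (X closure_of s - t)"
proof (rule closed_compactin[OF compactin_closure[OF assms(1)]])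
  show "closedin X (X closure_of s - t)"
    using S_open[OF assms(2)] by (simp add: closedin_diff)
qed auto

lemma S_subset_closure: "s \<in> S \<Longrightarrow> s \<subseteq> X closure_of s"
  by (simp add: closure_of_subset S_subset)

text \<open>\<open>X closure_of t - s\<close> is compact and misses \<open>x\<close>, so some member
  of \<open>S\<close> missing \<open>x\<close> contains it; this \<open>i\<close> replaces a
  complement of \<open>s\<close> in \<open>t\<close>.\<close>

lemma complement_avoid:
  assumes "s \<in> S" "t \<in> S" "x \<in> s"
  obtains i where "i \<in> S" "x \<notin> i" "t \<subseteq> s \<union> i"
proof -
  obtain i where "i \<in> S" "X closure_of t - s \<subseteq> i" "x \<notin> i"
    using compact_avoid[OF compactin_closure_diff[OF assms(2,1)], of x] assms S_subset by blast
  then show thesis using that S_subset_closure[OF assms(2)] by blast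
qed

section \<open>The inclusion order as a subfit round semilattice\<close>

abbreviation "L \<equiv> inclusion_order S"

lemma carrier_L [simp]: "carrier L = S"
  and le_L [simp]: "s \<sqsubseteq>\<^bsub>L\<^esub> t \<longleftrightarrow> s \<subseteq> t"
  by (simp_all add: inclusion_order_def)

lemma join_L [simp]: "\<lbrakk>s \<in> S; t \<in> S\<rbrakk> \<Longrightarrow> s \<squnion>\<^bsub>L\<^esub> t = s \<union> t"
  by (simp add: join_inclusion_order S_union)

lemma upper_semilattice_L: "upper_semilattice L"
proof
  fix s t
  assume "s \<in> carrier L" "t \<in> carrier L"
  then have "least L (s \<union> t) (Upper L {s, t})"
    by (simp add: least_def Upper_def S_union)
  then show "\<exists>u. least L u (Upper L {s, t})" by blast
qed (auto simp: inclusion_order_def)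

lemma subfit_L: "subfit L"
  unfolding subfit_def carrier_L le_L
proof (intro ballI iffI allI impI)
  fix p q p'
  assume S: "p \<in> S" "q \<in> S" "p' \<in> S" and "\<not> p \<subseteq> q" "p \<subseteq> p'"
  then obtain x where x: "x \<in> p" "x \<notin> q" by blast
  \<comment> \<open>\<open>i\<close> contains what \<open>p\<close> leaves of \<open>p'\<close> but
    not \<open>x\<close>, so \<open>q' = q \<union> i\<close> misses
    \<open>x \<in> p'\<close>.\<close>
  obtain i where i: "i \<in> S" "x \<notin> i" "p' \<subseteq> p \<union> i"
    using complement_avoid[OF S(1,3) x(1)] by blast
  show "\<exists>q'\<in>S. q \<subseteq> q' \<and> p' \<subseteq> p \<squnion>\<^bsub>L\<^esub> q' \<and> \<not> p' \<subseteq> q'"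
    using S i x \<open>p \<subseteq> p'\<close> by (intro bexI[of _ "q \<union> i"]) (auto simp: S_union)
next
  fix p q
  assume S: "p \<in> S" "q \<in> S"
    and *: "\<forall>p'\<in>S. p \<subseteq> p' \<longrightarrow> (\<exists>q'\<in>S. q \<subseteq> q' \<and> p' \<subseteq> p \<squnion>\<^bsub>L\<^esub> q' \<and> \<not> p' \<subseteq> q')"
  \<comment> \<open>The instance \<open>p' = p\<close>.\<close>
  obtain q' where "q' \<in> S" "q \<subseteq> q'" "\<not> p \<subseteq> q'" using * S by blast
  then show "\<not> p \<subseteq> q" by blast
qed

text \<open>As \<open>S\<close> covers the space, a member containing \<open>x\<close> can be added
  to \<open>F\<close>; then \<open>\<Inter>F\<close> lies in the space without being intersected
  with it.\<close>

lemma neighbourhood: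
  assumes "openin X T" "x \<in> T"
  obtains F where "finite F" "F \<noteq> {}" "F \<subseteq> S" "x \<in> \<Inter>F" "\<Inter>F \<subseteq> T"
proof -
  obtain F where F: "finite F" "F \<subseteq> S" "x \<in> \<Inter>F" "topspace X \<inter> \<Inter>F \<subseteq> T"
    using assms unfolding openin_X by (rule subbase_neighbourhood)
  have "x \<in> topspace X" using assms openin_subset by blast
  then obtain s where "s \<in> S" "x \<in> s" using S_separation(2) by blast
  then show thesis
    using F S_subset[of s] by (intro that[of "insert s F"]) auto
qed

text \<open>Finite intersections of members of \<open>S\<close> are closed under unions, by distributivity.\<close>

lemma compact_subset_Inter:
  assumes K: "compactin X K" "K \<noteq> {}" and T: "openin X T" "K \<subseteq> T"
  obtains F where "finite F" "F \<subseteq> S" "K \<subseteq> \<Inter>F" "\<Inter>F \<subseteq> T"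
proof -
  let ?B = "{\<Inter>F |F. finite F \<and> F \<noteq> {} \<and> F \<subseteq> S \<and> \<Inter>F \<subseteq> T}"
  have "K \<subseteq> \<Union>?B"
  proof
    fix x
    assume "x \<in> K"
    then obtain F where "finite F" "F \<noteq> {}" "F \<subseteq> S" "x \<in> \<Inter>F" "\<Inter>F \<subseteq> T"
      using neighbourhood[OF T(1)] T(2) by blast
    then show "x \<in> \<Union>?B" by blast
  qed
  moreover have "\<forall>U\<in>?B. openin X U"
    using S_open by (auto intro!: openin_Inter)
  ultimately obtain \<F> where \<F>: "finite \<F>" "\<F> \<subseteq> ?B" "K \<subseteq> \<Union>\<F>"
    using K(1) unfolding compactin_def by meson
  have "\<exists>F. finite F \<and> F \<subseteq> S \<and> \<Union>\<F> \<subseteq> \<Inter>F \<and> \<Inter>F \<subseteq> T" if "\<F> \<noteq> {}"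
    using \<F>(1) that \<F>(2)
  proof (induction \<F> rule: finite_ne_induct)
    case (singleton U)
    then show ?case by auto
  next
    case (insert U \<F>)
    then obtain F G where "finite F" "F \<subseteq> S" "\<Union>\<F> \<subseteq> \<Inter>F" "\<Inter>F \<subseteq> T"
      "finite G" "G \<subseteq> S" "U = \<Inter>G" "\<Inter>G \<subseteq> T" by auto
    moreover have "\<Inter>((\<lambda>(f, g). f \<union> g) ` (F \<times> G)) = \<Inter>F \<union> \<Inter>G" by auto
    moreover have "(\<lambda>(f, g). f \<union> g) ` (F \<times> G) \<subseteq> S"
      using S_union \<open>F \<subseteq> S\<close> \<open>G \<subseteq> S\<close> by (auto simp: subset_iff)
    ultimately show ?case
      by (intro exI[of _ "(\<lambda>(f, g). f \<union> g) ` (F \<times> G)"]) auto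
  qed
  then show thesis using that \<F>(3) K(2) by blast
qed

text \<open>Take \<open>t \<in> S\<close> containing the compact closure of \<open>s\<close>. For
  \<open>u\<close> not inside \<open>t\<close>, the nonempty compact set
  \<open>X closure_of u - t\<close> misses that closure, so it lies in a finite intersection
  \<open>\<Inter>F\<close> disjoint from it. Disjointness makes \<open>F \<union> {s}\<close> far,
  and \<open>u \<subseteq> f \<union> t\<close> for every \<open>f \<in> F\<close>.\<close>

lemma round_L: "round_order L"
  unfolding round_order_def carrier_L
proof
  fix s
  assume s: "s \<in> S"
  have "X closure_of s \<subseteq> \<Union>S"
    using S_separation(2) closure_of_subset_topspace[of X s] by blast
  then obtain t where t: "t \<in> S" "X closure_of s \<subseteq> t"
    using s S_union by (elim compact_cover[OF compactin_closure[OF s]]) auto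
  have "\<exists>F. finite F \<and> F \<subseteq> S \<and> far L (F \<union> {s}) \<and> (\<forall>f\<in>F. u \<subseteq> f \<squnion>\<^bsub>L\<^esub> t)"
    if u: "u \<in> S" "\<not> u \<subseteq> t" for u
  proof -
    have "openin X (topspace X - X closure_of s)"
      by (simp add: openin_diff)
    moreover have "X closure_of u - t \<noteq> {}" "X closure_of u - t \<subseteq> topspace X - X closure_of s"
      using t S_subset_closure[OF u(1)] u(2) closure_of_subset_topspace[of X u] by auto
    ultimately obtain F where F: "finite F" "F \<subseteq> S" "X closure_of u - t \<subseteq> \<Inter>F"
      "\<Inter>F \<subseteq> topspace X - X closure_of s"
      using compact_subset_Inter[OF compactin_closure_diff[OF u(1) t(1)]] by metis
    have "far L (F \<union> {s})"
      unfolding far_def carrier_L le_L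
    proof (intro conjI ballI impI)
      fix p q
      assume pq: "p \<in> S" "q \<in> S" "\<forall>f\<in>F \<union> {s}. p \<subseteq> q \<squnion>\<^bsub>L\<^esub> f"
      have "p \<subseteq> q \<union> f" if "f \<in> F \<union> {s}" for f
      proof -
        have "f \<in> S" using that F(2) s by auto
        then show ?thesis using pq that join_L[of q f] by metis
      qed
      then have "p \<subseteq> q \<union> (\<Inter>F \<inter> s)" by blast
      then show "p \<subseteq> q" using F(4) S_subset_closure[OF s] by blast
    qed (use F s in auto)
    moreover have "u \<subseteq> f \<squnion>\<^bsub>L\<^esub> t" if "f \<in> F" for f
    proof -
      have "u \<subseteq> f \<union> t" using F(3) that S_subset_closure[OF u(1)] by blast
      then show ?thesis using F(2) that t join_L[of f t] by (metis subsetD)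
    qed
    ultimately show ?thesis using F by blast
  qed
  then show "\<exists>t\<in>S. rather_below L s t"
    unfolding rather_below_def carrier_L le_L using s t by blast
qed

section \<open>Points of the space as points of the spectrum\<close>

text \<open>Maximality of the complement is \<open>complement_avoid\<close>; nonemptiness and
  properness come from the T1 condition with one empty set.\<close>

lemma point_in_spectrum:
  assumes x: "x \<in> topspace X"
  shows "{s \<in> S. x \<in> s} \<in> spectrum L"
  unfolding upper_semilattice.spectrum_iff[OF upper_semilattice_L] carrier_L le_L
proof (intro conjI ballI)
  show "{s \<in> S. x \<in> s} \<noteq> {}" "{s \<in> S. x \<in> s} \<subset> S"
    using S_separation[OF x] by blast+
  show "vee_ideal L (S - {s \<in> S. x \<in> s})"
    unfolding vee_ideal_def by auto
  fix s t
  assume s: "s \<in> {s \<in> S. x \<in> s}" and t: "t \<in> S"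
  then obtain i where "i \<in> S" "x \<notin> i" "t \<subseteq> s \<union> i"
    using complement_avoid[of s t x] by blast
  then show "\<exists>i\<in>S - {s \<in> S. x \<in> s}. t \<subseteq> s \<squnion>\<^bsub>L\<^esub> i"
    using s by (intro bexI[of _ i]) auto
qed

text \<open>Fix \<open>g \<in> G\<close>. If members outside \<open>G\<close> covered the compact
  closure of \<open>g\<close>, one of them would contain \<open>g\<close>, against upward closure of
  \<open>G\<close>. So some \<open>x\<close> in the closure lies in no member outside
  \<open>G\<close>, and minimality identifies \<open>G\<close> with the grill of
  \<open>x\<close>.\<close>

lemma spectrum_point:
  assumes G: "G \<in> spectrum L"
  obtains x where "x \<in> topspace X" "G = {s \<in> S. x \<in> s}"
proof -
  have GS: "G \<subseteq> S" "G \<noteq> {}" "S - G \<noteq> {}" and I: "vee_ideal L (S - G)"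
    using G unfolding upper_semilattice.spectrum_iff[OF upper_semilattice_L] by auto
  obtain g where g: "g \<in> G" "g \<in> S" using GS by blast
  have union: "s \<union> t \<in> S - G" if "s \<in> S - G" "t \<in> S - G" for s t
    using upper_semilattice.vee_ideal_joinI[OF upper_semilattice_L I that] that by simp
  have "\<not> X closure_of g \<subseteq> \<Union>(S - G)"
  proof
    assume "X closure_of g \<subseteq> \<Union>(S - G)"
    then obtain i where i: "i \<in> S - G" "X closure_of g \<subseteq> i"
      using GS(3) union by (rule compact_cover[OF compactin_closure[OF g(2)] _ Diff_subset])
    then have "g \<in> S - G"
      using upper_semilattice.vee_ideal_downI[OF upper_semilattice_L I i(1), of g] g
        S_subset_closure[OF g(2)] by auto
    then show False using g by blast
  qed
  then obtain x where x: "x \<in> X closure_of g" "x \<notin> \<Union>(S - G)" by blast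
  then have xX: "x \<in> topspace X" by (simp add: in_closure_of)
  have "{s \<in> S. x \<in> s} \<subseteq> G" using x by blast
  then have "{s \<in> S. x \<in> s} = G"
    using point_in_spectrum[OF xX] G unfolding spectrum_def by blast
  then show thesis using that xX by blast
qed

text \<open>The bijection carries each \<open>s \<in> S\<close> to
  \<open>spectrum_basic L s\<close>, and these sets form subbases of the two topologies, so
  continuity both ways is checked on them.\<close>

lemma homeomorphic_spectrum:
  "homeomorphic_map X (spectrum_topology L) (\<lambda>x. {s \<in> S. x \<in> s})"
proof -
  let ?f = "\<lambda>x. {s \<in> S. x \<in> s}"
  have inj: "inj_on ?f (topspace X)"
    using S_separation(1) by (intro inj_onI) blast
  have X_top: "X = topology (arbitrary union_of
      (finite intersection_of (\<lambda>s. s \<in> S) relative_to topspace X))"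
    by (simp flip: openin_X add: openin_inverse)
  have cont: "continuous_map X (spectrum_topology L) ?f"
    unfolding spectrum_topology_def
  proof (rule continuous_map_into_topology_subbase)
    fix x
    assume "x \<in> topspace X"
    then show "?f x \<in> topspace (topology (arbitrary union_of (finite intersection_of
        (\<lambda>U. U \<in> spectrum_basic L ` carrier L) relative_to spectrum L)))"
      using point_in_spectrum by (simp add: topspace_subbase)
  next
    fix U
    assume "U \<in> spectrum_basic L ` carrier L"
    then obtain s where s: "s \<in> S" "U = spectrum_basic L s" by auto
    have "{x \<in> topspace X. ?f x \<in> U} = s"
      using s point_in_spectrum S_subset[OF s(1)] by (auto simp: spectrum_basic_def)
    then show "openin X {x \<in> topspace X. ?f x \<in> U}"
      using S_open[OF s(1)] by simp
  qed
  define g where "g = inv_into (topspace X) ?f"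
  have gf: "g (?f x) = x" if "x \<in> topspace X" for x
    unfolding g_def using inv_into_f_f[OF inj that] .
  have fg: "g G \<in> topspace X \<and> ?f (g G) = G" if G: "G \<in> spectrum L" for G
    using spectrum_point[OF G] gf by metis
  have "continuous_map (spectrum_topology L) X g"
    unfolding continuous_map_into_topology_subbase_eq[OF X_top] topspace_spectrum_topology
  proof (intro conjI allI impI)
    show "g \<in> spectrum L \<rightarrow> topspace X" using fg by blast
    fix s
    assume s: "s \<in> S"
    have "{G \<in> spectrum L. g G \<in> s} = spectrum_basic L s"
      using fg s unfolding spectrum_basic_def by blast
    then show "openin (spectrum_topology L) {G \<in> spectrum L. g G \<in> s}"
      using upper_semilattice.openin_spectrum_basic[OF upper_semilattice_L] s by simp
  qed
  then have "homeomorphic_maps X (spectrum_topology L) ?f g"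
    unfolding homeomorphic_maps_def using cont gf fg by simp
  then show ?thesis by (rule homeomorphic_maps_imp_map)
qed

end

section \<open>The two directions of the duality\<close>

theorem theorem7p9:
  fixes X :: "'x topology" and S :: "'x set set" and L :: "('a, 'm) gorder_scheme"
  shows "(locally_closed_compact_space X \<and> union_subbasis X S \<and> T1_family (topspace X) S \<and>
           (\<forall>s\<in>S. relatively_compactin X s)
          \<longrightarrow> vee_semilattice (inclusion_order S) \<and> subfit (inclusion_order S) \<and>
              round_order (inclusion_order S) \<and>
              homeomorphic_map X (spectrum_topology (inclusion_order S)) (\<lambda>x. {s \<in> S. x \<in> s}))
         \<and>
         (vee_semilattice L \<and> subfit L \<and> round_order L
          \<longrightarrow> locally_closed_compact_space (spectrum_topology L) \<and>
              t1_space (spectrum_topology L) \<and>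
              union_subbasis (spectrum_topology L) (spectrum_basic L ` carrier L) \<and>
              T1_family (spectrum L) (spectrum_basic L ` carrier L) \<and>
              (\<forall>p\<in>carrier L. relatively_compactin (spectrum_topology L) (spectrum_basic L p)) \<and>
              (\<forall>p\<in>carrier L. \<forall>q\<in>carrier L.
                p \<sqsubseteq>\<^bsub>L\<^esub> q \<longleftrightarrow> spectrum_basic L p \<subseteq> spectrum_basic L q))"
proof (intro conjI[of "_ \<longrightarrow> _" "_ \<longrightarrow> _"] impI; elim conjE)
  assume "locally_closed_compact_space X" "union_subbasis X S" "T1_family (topspace X) S"
    "\<forall>s\<in>S. relatively_compactin X s"
  then interpret relatively_compact_subbasis X S
    by unfold_locales auto
  have "vee_semilattice (inclusion_order S)"
    using upper_semilattice_L subbasis unfolding vee_semilattice_def union_subbasis_def by simp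
  then show "vee_semilattice (inclusion_order S) \<and> subfit (inclusion_order S) \<and>
      round_order (inclusion_order S) \<and>
      homeomorphic_map X (spectrum_topology (inclusion_order S)) (\<lambda>x. {s \<in> S. x \<in> s})"
    using subfit_L round_L homeomorphic_spectrum by simp
next
  assume L: "vee_semilattice L" "subfit L" "round_order L"
  then interpret upper_semilattice L
    unfolding vee_semilattice_def by simp
  have "carrier L \<noteq> {}" using L(1) unfolding vee_semilattice_def by simp
  then show "locally_closed_compact_space (spectrum_topology L) \<and>
      t1_space (spectrum_topology L) \<and>
      union_subbasis (spectrum_topology L) (spectrum_basic L ` carrier L) \<and>
      T1_family (spectrum L) (spectrum_basic L ` carrier L) \<and>
      (\<forall>p\<in>carrier L. relatively_compactin (spectrum_topology L) (spectrum_basic L p)) \<and>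
      (\<forall>p\<in>carrier L. \<forall>q\<in>carrier L.
        p \<sqsubseteq>\<^bsub>L\<^esub> q \<longleftrightarrow> spectrum_basic L p \<subseteq> spectrum_basic L q)"
    using locally_closed_compact_spectrum[OF L(2,3)] t1_spectrum union_subbasis_spectrum
      T1_spectrum_basic relatively_compactin_spectrum_basic[OF L(2,3)]
      le_iff_spectrum_basic_subset[OF L(2,3)]
    by blast
qed

end
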